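(* Let $q=p^n$ be a prime power, let $d_1,d_2\ge 1$ be integers, let $P(X,Z)\in\mathbb{F}_q[X,Z]$ be monic in $Z$ with $\deg_Z P\ge 2$ and let $Q(X,Y,Z)\in\mathbb{F}_q[X,Y,Z]$ be monic in $Y$ with $\deg_Y Q\ge 2$. Let $$S_{d_1,d_2}(\mathbb{F}_q)=\{(\alpha,\beta,\gamma,\kappa)\in\mathbb{F}_q^4\mid \alpha^{d_1}\beta=P(\alpha,\gamma),\ \alpha^{d_2}\kappa=Q(\alpha,\beta,\gamma)\}.$$ Then: (1) if $P(0,Z)=Z^2$ and $Q(0,Y,Z)=Y^2$, then $\#S_{d_1,d_2}(\mathbb{F}_q)=q^2$, which is the $q$-th square number $S_4(q)$; (2) if $P(0,Z)=Z^q-Z$ and $Q(0,Y,Z)=Y^2$, then $\#S_{d_1,d_2}(\mathbb{F}_q)=2q^2-q$, which is the $q$-th hexagonal number $S_6(q)$; (3) if $P(0,Z)=Z^q-Z$ and $Q(0,Y,Z)=Y^2-ZY$, then $\#S_{d_1,d_2}(\mathbb{F}_q)=3q^2-2q$, which is the $q$-th octagonal number $S_8(q)$; (4) if $P(0,Z)=Z^q-Z$ and $Q(0,Y,Z)=Y^4-Y+Z(Y^2-Y)$, then $\#S_{d_1,d_2}(\mathbb{F}_q)=4q^2-3q$, which is the $q$-th decagonal number $S_{10}(q)$.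
   Context: $\mathbb{F}_q$ is the finite field with $q$ elements. For $m\ge 3$, the $n$-th $m$-gonal number is $S_m(n)=\sum_{k=0}^{n-1}(1+k(m-2))=\frac{n}{2}\bigl((m-2)n-(m-4)\bigr)$. "Monic in $Z$" means that, viewed as a polynomial in $Z$ with coefficients in the ring of polynomials in the other variables, the leading coefficient is $1$; similarly for "monic in $Y$". *)

theory Defs
  imports "HOL-Computational_Algebra.Computational_Algebra" "HOL-Library.Cardinality"
begin

definition polygonal :: "nat \<Rightarrow> nat \<Rightarrow> int" where
  "polygonal m n = (\<Sum>k<n. 1 + int k * (int m - 2))"

lemma polygonal_closed_form:
  "2 * polygonal m n = int n * ((int m - 2) * int n - (int m - 4))"
  unfolding polygonal_def by (induction n) (simp_all add: algebra_simps)

text \<open>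
  Multivariate polynomials are iterated univariate ones. An element of $K[X,Z]$ is a polynomial
  in $Z$ over $K[X]$, of type \<^typ>\<open>'a poly poly\<close>; an element of $K[X,Y,Z]$ is a polynomial in $Y$
  over $K[X,Z]$, of type \<^typ>\<open>'a poly poly poly\<close> (outermost $Y$, then $Z$, innermost $X$). Thus
  \<^term>\<open>degree\<close> and \<^term>\<open>lead_coeff\<close> refer to $Z$ in the first case and to $Y$ in the second.
\<close>

text \<open>Substitution of a constant for the inner variable: $P(X,Z) \mapsto P(a,Z)$.\<close>

definition subst_inner :: "'a::comm_semiring_0 poly poly \<Rightarrow> 'a \<Rightarrow> 'a poly" where
  "subst_inner P a = map_poly (\<lambda>c. poly c a) P"

text \<open>$Q(X,Y,Z) \mapsto Q(a,Y,Z)$; the result is a polynomial in $Y$ over $K[Z]$.\<close>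

definition subst_X3 :: "'a::comm_semiring_0 poly poly poly \<Rightarrow> 'a \<Rightarrow> 'a poly poly" where
  "subst_X3 Q a = map_poly (\<lambda>r. subst_inner r a) Q"

definition eval_XZ :: "'a::comm_semiring_0 poly poly \<Rightarrow> 'a \<Rightarrow> 'a \<Rightarrow> 'a" where
  "eval_XZ P a c = poly (subst_inner P a) c"

definition eval_XYZ :: "'a::comm_semiring_0 poly poly poly \<Rightarrow> 'a \<Rightarrow> 'a \<Rightarrow> 'a \<Rightarrow> 'a" where
  "eval_XYZ Q a b c = poly (subst_inner (subst_X3 Q a) c) b"

text \<open>
  The indeterminate $Z$ of $K[Z]$ and the indeterminate $Y$ of $K[Z][Y]$. In $K[Z][Y]$ the
  indeterminate $Z$ is the constant polynomial \<open>[:varZ:]\<close>.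
\<close>

abbreviation varZ :: "'a::comm_ring_1 poly" where
  "varZ \<equiv> [:0, 1:]"

abbreviation varY :: "'a::comm_ring_1 poly poly" where
  "varY \<equiv> [:0, 1:]"

definition surface_points ::
  "nat \<Rightarrow> nat \<Rightarrow> 'a::field poly poly \<Rightarrow> 'a poly poly poly \<Rightarrow> ('a \<times> 'a \<times> 'a \<times> 'a) set" where
  "surface_points d1 d2 P Q =
     {(\<alpha>, \<beta>, \<gamma>, \<kappa>). \<alpha> ^ d1 * \<beta> = eval_XZ P \<alpha> \<gamma> \<and> \<alpha> ^ d2 * \<kappa> = eval_XYZ Q \<alpha> \<beta> \<gamma>}"

end

theory Submission
  imports Defs
begin

text \<open>
  Over \<open>\<alpha> \<noteq> 0\<close> the two equations determine \<open>\<beta>\<close> and \<open>\<kappa>\<close> from \<open>\<alpha>, \<gamma>\<close>, giving \<open>q (q - 1)\<close>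
  points. Over \<open>\<alpha> = 0\<close> the coordinate \<open>\<kappa>\<close> is free, so the points number \<open>q\<close> times the zeros
  \<open>(\<beta>, \<gamma>)\<close> of the plane system \<open>P(0,\<gamma>) = 0 = Q(0,\<beta>,\<gamma>)\<close>, counted by factoring \<open>Q(0,Y,Z)\<close>.
\<close>

text \<open>Multiplication by \<open>x \<noteq> 0\<close> permutes the nonzero elements, so it
  preserves their product. Cancelling that nonzero product leaves
  \<open>x ^ (CARD('a) - 1) = 1\<close>.\<close>

lemma finite_field_power_card:
  fixes x :: "'a::{field,finite}"
  shows "x ^ CARD('a) = x"
proof (cases "x = 0")
  case True
  then show ?thesis by (simp add: power_0_left)
next
  case False
  let ?U = "UNIV - {0 :: 'a}"
  have "bij_betw ((*) x) ?U ?U"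
    by (rule bij_betw_byWitness[where f' = "\<lambda>y. y / x"]) (use False in auto)
  then have "(\<Prod>y\<in>?U. x * y) = \<Prod>?U"
    by (rule prod.reindex_bij_betw)
  then have "x ^ card ?U = 1"
    by (simp add: prod.distrib)
  moreover have "CARD('a) = Suc (card ?U)"
    by (simp add: card_Diff_singleton)
  ultimately show ?thesis by (simp only: power_Suc mult_1_right)
qed

lemma card_surface_points:
  fixes P :: "'a::{field,finite} poly poly"
  assumes "d1 \<ge> 1" and "d2 \<ge> 1"
  shows "card (surface_points d1 d2 P Q) = CARD('a) * (CARD('a) - 1)
    + CARD('a) * card {(\<beta>, \<gamma>). eval_XZ P 0 \<gamma> = 0 \<and> eval_XYZ Q 0 \<beta> \<gamma> = 0}"
proof -
  define V where "V = {(\<beta>, \<gamma>). eval_XZ P 0 \<gamma> = 0 \<and> eval_XYZ Q 0 \<beta> \<gamma> = 0}"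
  \<comment> \<open>\<open>B\<close> is the value of \<beta> forced by the first equation when
    \<alpha> is nonzero; \<open>f\<close> inserts it into the second equation to obtain \<kappa>.
    \<open>g\<close> attaches a free \<kappa> to a plane zero.\<close>
  define B where "B \<alpha> \<gamma> = eval_XZ P \<alpha> \<gamma> / \<alpha> ^ d1" for \<alpha> \<gamma>
  define f where "f = (\<lambda>(\<alpha>, \<gamma>). (\<alpha>, B \<alpha> \<gamma>, \<gamma>, eval_XYZ Q \<alpha> (B \<alpha> \<gamma>) \<gamma> / \<alpha> ^ d2))"
  define g where "g = (\<lambda>((\<beta>, \<gamma>), \<kappa>). (0 :: 'a, \<beta> :: 'a, \<gamma> :: 'a, \<kappa> :: 'a))"
  let ?U = "(UNIV - {0 :: 'a}) \<times> (UNIV :: 'a set)"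
  let ?W = "V \<times> (UNIV :: 'a set)"
  have split: "surface_points d1 d2 P Q = f ` ?U \<union> g ` ?W"
  proof (rule set_eqI)
    fix t :: "'a \<times> 'a \<times> 'a \<times> 'a"
    obtain \<alpha> \<beta> \<gamma> \<kappa> where t: "t = (\<alpha>, \<beta>, \<gamma>, \<kappa>)"
      by (cases t)
    show "t \<in> surface_points d1 d2 P Q \<longleftrightarrow> t \<in> f ` ?U \<union> g ` ?W"
    proof (cases "\<alpha> = 0")
      case True
      \<comment> \<open>Both exponents are positive, so the left-hand sides vanish at \<alpha> = 0
        and \<kappa> drops out.\<close>
      have "t \<in> surface_points d1 d2 P Q \<longleftrightarrow> (\<beta>, \<gamma>) \<in> V"
        using assms True by (auto simp: t surface_points_def V_def power_0_left)
      moreover have "t \<in> g ` ?W \<longleftrightarrow> (\<beta>, \<gamma>) \<in> V"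
        using True by (force simp: t g_def)
      moreover have "t \<notin> f ` ?U"
        using True by (auto simp: t f_def)
      ultimately show ?thesis by simp
    next
      case False
      have "t \<in> surface_points d1 d2 P Q \<longleftrightarrow> t = f (\<alpha>, \<gamma>)"
      proof -
        have "\<alpha> ^ d1 * \<beta> = eval_XZ P \<alpha> \<gamma> \<longleftrightarrow> \<beta> = B \<alpha> \<gamma>"
          using False by (simp add: B_def eq_divide_eq mult.commute)
        moreover have "\<alpha> ^ d2 * \<kappa> = z \<longleftrightarrow> \<kappa> = z / \<alpha> ^ d2" for z
          using False by (simp add: eq_divide_eq mult.commute)
        ultimately show ?thesis
          by (auto simp: t surface_points_def f_def)
      qed
      moreover have "t \<in> f ` ?U \<longleftrightarrow> t = f (\<alpha>, \<gamma>)"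
        using False by (auto simp: t f_def)
      moreover have "t \<notin> g ` ?W"
        using False by (auto simp: t g_def)
      ultimately show ?thesis by simp
    qed
  qed
  \<comment> \<open>The arguments of \<open>f\<close> and \<open>g\<close> reappear among the
    coordinates of their values; the images are separated by whether \<alpha> is 0.\<close>
  have "inj_on f ?U" "inj_on g ?W"
    by (auto simp: f_def g_def inj_on_def)
  moreover have "f ` ?U \<inter> g ` ?W = {}"
    by (auto simp: f_def g_def)
  ultimately have "card (surface_points d1 d2 P Q) = card ?U + card ?W"
    unfolding split by (simp add: card_Un_disjoint card_image)
  then show ?thesis
    by (simp add: V_def card_cartesian_product card_Diff_singleton mult.commute)
qed

text \<open>Passing to integers removes the truncated subtraction. The plane zero set is a parameter
  \<open>V\<close>, so that each case need only supply it in a form that can be counted.\<close>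

lemma int_card_surface_points:
  fixes P :: "'a::{field,finite} poly poly"
  assumes "d1 \<ge> 1" and "d2 \<ge> 1"
    and "{(\<beta>, \<gamma>). eval_XZ P 0 \<gamma> = 0 \<and> eval_XYZ Q 0 \<beta> \<gamma> = 0} = V"
  shows "int (card (surface_points d1 d2 P Q))
    = int CARD('a) ^ 2 - int CARD('a) + int CARD('a) * int (card V)"
proof -
  have "CARD('a) \<ge> 1"
    using zero_less_card_finite[where 'a = 'a] by simp
  then show ?thesis
    unfolding card_surface_points[OF assms(1,2)] assms(3)
    by (simp add: power2_eq_square right_diff_distrib)
qed

text \<open>Since \<beta>(\<beta> - \<gamma>) is the factored form, the zeros are two lines of q
  points meeting at the origin. \<open>?B\<close> is the diagonal without the origin, which makes
  the union disjoint.\<close>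

lemma card_zeros_YY_minus_ZY:
  "card {(\<beta> :: 'a::{field,finite}, \<gamma>). \<beta>\<^sup>2 - \<gamma> * \<beta> = 0} = 2 * CARD('a) - 1"
proof -
  let ?A = "{0 :: 'a} \<times> (UNIV :: 'a set)" and ?B = "(\<lambda>b :: 'a. (b, b)) ` (UNIV - {0})"
  have "{(\<beta> :: 'a, \<gamma>). \<beta>\<^sup>2 - \<gamma> * \<beta> = 0} = ?A \<union> ?B"
    by (auto simp: power2_eq_square)
  moreover have "card (?A \<union> ?B) = card ?A + card ?B"
    by (rule card_Un_disjoint) auto
  moreover have "card ?B = CARD('a) - 1"
    by (subst card_image) (auto simp: inj_on_def card_Diff_singleton)
  ultimately show ?thesis
    using zero_less_card_finite[where 'a = 'a] by (simp add: card_cartesian_product)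
qed

text \<open>Both \<open>b ^ 4 - b\<close> and \<open>b\<^sup>2 - b\<close> are divisible by
  \<open>b * (b - 1)\<close>, and the remaining factor is linear in \<open>c\<close>.\<close>

lemma quartic_factorization:
  fixes b c :: "'a::comm_ring_1"
  shows "b ^ 4 - b + c * (b\<^sup>2 - b) = b * (b - 1) * (b\<^sup>2 + b + 1 + c)"
  by (simp add: eval_nat_numeral algebra_simps)

text \<open>The lines \<beta> = 0 and \<beta> = 1 contribute 2q zeros. For each of the other q - 2
  values of \<beta>, the factor linear in \<gamma> has exactly one root.\<close>

lemma card_zeros_quartic:
  "card {(\<beta> :: 'a::{field,finite}, \<gamma>). \<beta> ^ 4 - \<beta> + \<gamma> * (\<beta>\<^sup>2 - \<beta>) = 0} = 3 * CARD('a) - 2"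
proof -
  let ?A = "{0 :: 'a, 1} \<times> (UNIV :: 'a set)"
  let ?B = "(\<lambda>b :: 'a. (b, - (b\<^sup>2 + b + 1))) ` (UNIV - {0, 1})"
  have "{(\<beta> :: 'a, \<gamma>). \<beta> ^ 4 - \<beta> + \<gamma> * (\<beta>\<^sup>2 - \<beta>) = 0} = ?A \<union> ?B"
    unfolding quartic_factorization by (auto simp: add_eq_0_iff)
  moreover have "card (?A \<union> ?B) = card ?A + card ?B"
    by (rule card_Un_disjoint) auto
  moreover have "card ?B = CARD('a) - 2"
    by (subst card_image) (auto simp: inj_on_def card_Diff_subset)
  \<comment> \<open>As 0 and 1 differ, q - 2 is not truncated, and 2q + (q - 2) = 3q - 2 holds in
    the naturals.\<close>
  moreover have "CARD('a) \<ge> 2"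
    using card_mono[of UNIV "{0 :: 'a, 1}"] by simp
  ultimately show ?thesis
    by (simp add: card_cartesian_product)
qed

theorem theorem7p2:
  fixes P :: "'a::{field,finite} poly poly"
    and Q :: "'a poly poly poly"
    and p n q d1 d2 :: nat
  assumes "prime p" and "n \<ge> 1" and "q = p ^ n" and "CARD('a) = q"
    and "d1 \<ge> 1" and "d2 \<ge> 1"
    and "lead_coeff P = 1" and "degree P \<ge> 2"
    and "lead_coeff Q = 1" and "degree Q \<ge> 2"
  shows
    "(subst_inner P 0 = varZ ^ 2 \<and> subst_X3 Q 0 = varY ^ 2
        \<longrightarrow> int (card (surface_points d1 d2 P Q)) = int q ^ 2
            \<and> int q ^ 2 = polygonal 4 q) \<and>
     (subst_inner P 0 = varZ ^ q - varZ \<and> subst_X3 Q 0 = varY ^ 2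
        \<longrightarrow> int (card (surface_points d1 d2 P Q)) = 2 * int q ^ 2 - int q
            \<and> 2 * int q ^ 2 - int q = polygonal 6 q) \<and>
     (subst_inner P 0 = varZ ^ q - varZ \<and> subst_X3 Q 0 = varY ^ 2 - [:varZ:] * varY
        \<longrightarrow> int (card (surface_points d1 d2 P Q)) = 3 * int q ^ 2 - 2 * int q
            \<and> 3 * int q ^ 2 - 2 * int q = polygonal 8 q) \<and>
     (subst_inner P 0 = varZ ^ q - varZ
        \<and> subst_X3 Q 0 = varY ^ 4 - varY + [:varZ:] * (varY ^ 2 - varY)
        \<longrightarrow> int (card (surface_points d1 d2 P Q)) = 4 * int q ^ 2 - 3 * int q
            \<and> 4 * int q ^ 2 - 3 * int q = polygonal 10 q)"
proof -
  have card: "CARD('a) = q" by fact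
  have q: "q \<ge> 1"
    using zero_less_card_finite[where 'a = 'a] card by simp
  have frob: "x ^ q = x" for x :: 'a
    using finite_field_power_card[of x] card by simp
  \<comment> \<open>\<open>Z ^ q - Z\<close> vanishes at every field element, so the first equation
    leaves \<gamma> free at \<alpha> = 0.\<close>
  have P_eval: "eval_XZ P 0 \<gamma> = 0" if "subst_inner P 0 = varZ ^ q - varZ" for \<gamma>
    using that by (simp add: eval_XZ_def frob)
  have Q_eval: "eval_XYZ Q 0 \<beta> \<gamma> = \<beta>\<^sup>2" if "subst_X3 Q 0 = varY ^ 2" for \<beta> \<gamma>
    using that
    by (simp add: eval_XYZ_def subst_inner_def map_poly_pCons power2_eq_square)
  have Q_eval3: "eval_XYZ Q 0 \<beta> \<gamma> = \<beta>\<^sup>2 - \<gamma> * \<beta>"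
    if "subst_X3 Q 0 = varY ^ 2 - [:varZ:] * varY" for \<beta> \<gamma>
    using that
    by (simp add: eval_XYZ_def subst_inner_def map_poly_pCons power2_eq_square algebra_simps)
  have Q_eval4: "eval_XYZ Q 0 \<beta> \<gamma> = \<beta> ^ 4 - \<beta> + \<gamma> * (\<beta>\<^sup>2 - \<beta>)"
    if "subst_X3 Q 0 = varY ^ 4 - varY + [:varZ:] * (varY ^ 2 - varY)" for \<beta> \<gamma>
    using that
    by (simp add: eval_XYZ_def subst_inner_def map_poly_pCons power2_eq_square
        power4_eq_xxxx algebra_simps)
  note count = int_card_surface_points[OF \<open>d1 \<ge> 1\<close> \<open>d2 \<ge> 1\<close>, of P Q, unfolded card]
  have "int (card (surface_points d1 d2 P Q)) = int q ^ 2"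
    if h: "subst_inner P 0 = varZ ^ 2" "subst_X3 Q 0 = varY ^ 2"
  proof -
    have "{(\<beta>, \<gamma>). eval_XZ P 0 \<gamma> = 0 \<and> eval_XYZ Q 0 \<beta> \<gamma> = 0} = {(0, 0)}"
      using h(1) by (auto simp: eval_XZ_def Q_eval[OF h(2)])
    from count[OF this] show ?thesis by simp
  qed
  moreover have "int (card (surface_points d1 d2 P Q)) = 2 * int q ^ 2 - int q"
    if h: "subst_inner P 0 = varZ ^ q - varZ" "subst_X3 Q 0 = varY ^ 2"
  proof -
    \<comment> \<open>Only \<beta> is constrained, which leaves q zeros instead of the single origin
      of the first case.\<close>
    have "{(\<beta>, \<gamma>). eval_XZ P 0 \<gamma> = 0 \<and> eval_XYZ Q 0 \<beta> \<gamma> = 0} = {0} \<times> UNIV"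
      by (auto simp: P_eval[OF h(1)] Q_eval[OF h(2)])
    from count[OF this] show ?thesis
      by (simp add: card_cartesian_product card power2_eq_square)
  qed
  moreover have "int (card (surface_points d1 d2 P Q)) = 3 * int q ^ 2 - 2 * int q"
    if h: "subst_inner P 0 = varZ ^ q - varZ"
      "subst_X3 Q 0 = varY ^ 2 - [:varZ:] * varY"
  proof -
    have zeros: "int (card {(\<beta> :: 'a, \<gamma>). \<beta>\<^sup>2 - \<gamma> * \<beta> = 0}) = 2 * int q - 1"
      unfolding card_zeros_YY_minus_ZY card using q by simp
    have V: "{(\<beta>, \<gamma>). eval_XZ P 0 \<gamma> = 0 \<and> eval_XYZ Q 0 \<beta> \<gamma> = 0}
        = {(\<beta>, \<gamma>). \<beta>\<^sup>2 - \<gamma> * \<beta> = 0}"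
      by (simp only: P_eval[OF h(1)] Q_eval3[OF h(2)] simp_thms)
    show ?thesis
      unfolding count[OF V] zeros by (simp add: power2_eq_square right_diff_distrib)
  qed
  moreover have "int (card (surface_points d1 d2 P Q)) = 4 * int q ^ 2 - 3 * int q"
    if h: "subst_inner P 0 = varZ ^ q - varZ"
      "subst_X3 Q 0 = varY ^ 4 - varY + [:varZ:] * (varY ^ 2 - varY)"
  proof -
    have zeros: "int (card {(\<beta> :: 'a, \<gamma>). \<beta> ^ 4 - \<beta> + \<gamma> * (\<beta>\<^sup>2 - \<beta>) = 0}) = 3 * int q - 2"
      unfolding card_zeros_quartic card using q by simp
    have V: "{(\<beta>, \<gamma>). eval_XZ P 0 \<gamma> = 0 \<and> eval_XYZ Q 0 \<beta> \<gamma> = 0}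
        = {(\<beta>, \<gamma>). \<beta> ^ 4 - \<beta> + \<gamma> * (\<beta>\<^sup>2 - \<beta>) = 0}"
      by (simp only: P_eval[OF h(1)] Q_eval4[OF h(2)] simp_thms)
    show ?thesis
      unfolding count[OF V] zeros by (simp add: power2_eq_square right_diff_distrib)
  qed
  \<comment> \<open>With m = 2k + 2, the doubled closed form is 2(k q^2 - (k - 1) q); the four cases
    are k = 1, 2, 3, 4.\<close>
  moreover have "int q ^ 2 = polygonal 4 q" "2 * int q ^ 2 - int q = polygonal 6 q"
    "3 * int q ^ 2 - 2 * int q = polygonal 8 q" "4 * int q ^ 2 - 3 * int q = polygonal 10 q"
    using polygonal_closed_form[of 4 q] polygonal_closed_form[of 6 q]
      polygonal_closed_form[of 8 q] polygonal_closed_form[of 10 q]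
    by (simp_all add: power2_eq_square algebra_simps)
  ultimately show ?thesis by blast
qed

end
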